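(* Let $p\neq 0$ be a real number, $r=\frac{1-p}{p}$ (so that $1+r=1/p\neq 0$), let $N\ge 1$ be an integer, and let $j,m$ be integers with $0\le j\le N$ and $0\le m\le N$. Then $$\sum_{n=0}^m (N-2n)\,(\phi^{N}_{n\,j})^2=(N-j)\,(\phi^{N-1}_{m\,j})^2+r\,j\,(\phi^{N-1}_{m\,j-1})^2+\frac{1-r}{1+r}\;j\,\sum_{n=0}^m \left(r\,(\phi^{N}_{n\,j-1})^2+(\phi^{N}_{n\,j})^2\right).$$
   Context: For an integer $N\ge 0$ and an integer $0\le j\le N$, the Krawtchouk values $\phi^{N}_{n\,j}$ (with parameter $r$) are defined by the generating function $$(1+z)^{N-j}(1-rz)^j=\sum_{n=0}^N z^n\,\phi^{N}_{n\,j},$$ with $\phi^{N}_{n\,j}=0$ when $n<0$ or $n>N$. Terms whose column index is out of range ($\phi^{N-1}_{m\,j}$ for $j=N$, and $\phi^{N-1}_{m\,j-1}$, $\phi^N_{n\,j-1}$ for $j=0$) are multiplied by a zero coefficient and are read as $0$. *)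

theory Defs
  imports Complex_Main "HOL-Computational_Algebra.Polynomial"
begin

(* krawtchouk r N n j is the coefficient of z^n in (1 + z)^(N - j) * (1 - r z)^j.
   The indices n and j are integers, so that out-of-range values such as column -1
   are genuinely out of range and equal to 0. *)
definition krawtchouk :: "real \<Rightarrow> nat \<Rightarrow> int \<Rightarrow> int \<Rightarrow> real" where
  "krawtchouk r N n j =
     (if 0 \<le> n \<and> n \<le> int N \<and> 0 \<le> j \<and> j \<le> int N
      then coeff ([:1, 1:] ^ (N - nat j) * [:1, - r:] ^ nat j) (nat n)
      else 0)"

end

theory Submission
  imports Defs
begin

text \<open>Put \<open>F = (1 + z)^(N-j) * (1 - r z)^j\<close>, \<open>A = F / (1 + z)\<close> and \<open>B = F / (1 - r z)\<close>. The product
  rule \<open>F' = (N - j) A - r j B\<close> together with \<open>F = (1 + z) A = (1 - r z) B\<close> expresses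
  \<open>(N - 2 n) F\<^sub>n\<close> as \<open>(N - j) (A\<^sub>n - A\<^sub>n\<^sub>-\<^sub>1) + j (B\<^sub>n + r B\<^sub>n\<^sub>-\<^sub>1)\<close>. Multiplying by
  \<open>F\<^sub>n = A\<^sub>n + A\<^sub>n\<^sub>-\<^sub>1 = B\<^sub>n - r B\<^sub>n\<^sub>-\<^sub>1\<close> turns the first term into a telescoping
  difference of squares; the second one equals \<open>j (B\<^sub>n\<^sup>2 - r\<^sup>2 B\<^sub>n\<^sub>-\<^sub>1\<^sup>2)\<close>, which is a telescoping
  part plus the stated correction, because column \<open>j - 1\<close> has the entries \<open>B\<^sub>n + B\<^sub>n\<^sub>-\<^sub>1\<close>.\<close>

text \<open>Splitting the upper index as \<open>a + b\<close> avoids truncated subtraction. The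
  degree is at most \<open>a + b\<close>, so higher coefficients agree with the default 0.\<close>

lemma krawtchouk_add:
  "krawtchouk r (a + b) n (int b) =
     (if n < 0 then 0 else coeff ([:1, 1:] ^ a * [:1, - r:] ^ b) (nat n))"
proof -
  have "degree ([:1, 1::real:] ^ a * [:1, - r:] ^ b) \<le> a + b"
    by (intro order.trans[OF degree_mult_le] add_mono order.trans[OF degree_power_le]) auto
  then have "coeff ([:1, 1:] ^ a * [:1, - r:] ^ b) (nat n) = 0" if "n > int (a + b)"
    using that by (intro coeff_eq_0) linarith
  then show ?thesis
    by (auto simp: krawtchouk_def)
qed

lemma coeff_linear_mult:
  fixes q :: "real poly"
  shows "coeff ([:1, c:] * q) n = coeff q n + (if n = 0 then 0 else c * coeff q (n - 1))"
  by (cases n) auto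

lemma krawtchouk_Suc_same_column:
  "krawtchouk r (Suc (a + b)) n (int b) =
     krawtchouk r (a + b) n (int b) + krawtchouk r (a + b) (n - 1) (int b)"
  using krawtchouk_add[of r "Suc a" b n]
  by (simp add: krawtchouk_add mult.assoc coeff_linear_mult nat_diff_distrib del: mult_pCons_left)

lemma krawtchouk_Suc_next_column:
  "krawtchouk r (Suc (a + b)) n (1 + int b) =
     krawtchouk r (a + b) n (int b) - r * krawtchouk r (a + b) (n - 1) (int b)"
  using krawtchouk_add[of r a "Suc b" n]
  by (simp add: krawtchouk_add mult.left_commute[of _ "[:1, - r:]"] coeff_linear_mult
      nat_diff_distrib del: mult_pCons_left mult_pCons_right)

text \<open>Compares the coefficients of z^(n-1) in the product rule for F'.\<close>

lemma krawtchouk_deriv: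
  assumes "0 \<le> j" and "j \<le> int (Suc M)"
  shows "n * krawtchouk r (Suc M) n j =
     (real (Suc M) - j) * krawtchouk r M (n - 1) j - r * j * krawtchouk r M (n - 1) (j - 1)"
proof -
  define a b where "a = nat (int (Suc M) - j)" and "b = nat j"
  have ab: "a + b = Suc M" and j: "j = int b"
    using assms by (auto simp: a_def b_def)
  let ?u = "[:1, 1::real:]" and ?v = "[:1, - r:]"
  have F: "krawtchouk r (Suc M) n j = (if n < 0 then 0 else coeff (?u ^ a * ?v ^ b) (nat n))"
    using krawtchouk_add[of r a b n] ab j by simp
  \<comment> \<open>For \<open>a = 0\<close> the exponent \<open>a - 1\<close> truncates, but the
    factor \<open>real a\<close> makes both sides 0; likewise for \<open>b\<close> below.\<close>
  have A: "real a * krawtchouk r M (n - 1) j =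
      (if n < 1 then 0 else coeff (smult (real a) (?u ^ (a - 1) * ?v ^ b)) (nat (n - 1)))"
    using krawtchouk_add[of r "a - 1" b "n - 1"] ab j by (cases a) auto
  have B: "real b * krawtchouk r M (n - 1) (j - 1) =
      (if n < 1 then 0 else coeff (smult (real b) (?u ^ a * ?v ^ (b - 1))) (nat (n - 1)))"
    using krawtchouk_add[of r a "b - 1" "n - 1"] ab j by (cases b) auto
  have D: "pderiv (?u ^ a * ?v ^ b) =
      smult (real a) (?u ^ (a - 1) * ?v ^ b) + smult (- r * real b) (?u ^ a * ?v ^ (b - 1))"
    by (simp add: pderiv_mult pderiv_power pderiv_pCons mult.commute)
  have "n * krawtchouk r (Suc M) n j =
      real a * krawtchouk r M (n - 1) j - r * (real b * krawtchouk r M (n - 1) (j - 1))"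
  proof (cases "n < 1")
    case True
    then show ?thesis
      unfolding A B F by auto
  next
    case False
    then obtain k where k: "n = int (Suc k)"
      by (metis linorder_not_less zero_less_imp_eq_int gr0_conv_Suc int_one_le_iff_zero_less)
    have "real (Suc k) * coeff (?u ^ a * ?v ^ b) (Suc k) = coeff (pderiv (?u ^ a * ?v ^ b)) k"
      by (simp add: coeff_pderiv)
    also have "\<dots> = coeff (smult (real a) (?u ^ (a - 1) * ?v ^ b)) k
        - r * coeff (smult (real b) (?u ^ a * ?v ^ (b - 1))) k"
      unfolding D by simp
    finally show ?thesis
      unfolding A B F unfolding k by (simp add: nat_add_distrib)
  qed
  moreover have "real a = real (Suc M) - j" "real b = j"
    using ab j by auto
  ultimately show ?thesis
    by (simp add: mult.assoc)
qed

text \<open>The right-hand side is the increment of the theorem's right-hand side from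
  \<open>m = n - 1\<close> to \<open>m = n\<close>.\<close>

lemma krawtchouk_square_step:
  assumes "1 + r \<noteq> 0" and j: "0 \<le> j" "j \<le> int (Suc M)"
  shows "(real (Suc M) - 2 * real_of_int n) * (krawtchouk r (Suc M) n j)\<^sup>2 =
      (real (Suc M) - j) * ((krawtchouk r M n j)\<^sup>2 - (krawtchouk r M (n - 1) j)\<^sup>2)
      + r * j * ((krawtchouk r M n (j - 1))\<^sup>2 - (krawtchouk r M (n - 1) (j - 1))\<^sup>2)
      + (1 - r) / (1 + r) * j *
          (r * (krawtchouk r (Suc M) n (j - 1))\<^sup>2 + (krawtchouk r (Suc M) n j)\<^sup>2)"
proof -
  define F G A A' B B' where "F = krawtchouk r (Suc M) n j"
    and "G = krawtchouk r (Suc M) n (j - 1)"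
    and "A = krawtchouk r M n j" and "A' = krawtchouk r M (n - 1) j"
    and "B = krawtchouk r M n (j - 1)" and "B' = krawtchouk r M (n - 1) (j - 1)"
  note defs = F_def G_def A_def A'_def B_def B'_def
  define x y where "x = real (Suc M) - j" and "y = real_of_int j"
  have deriv: "n * F = x * A' - r * y * B'"
    using krawtchouk_deriv[OF j] by (simp add: defs x_def y_def)
  have "F = A + A'" if "j \<noteq> int (Suc M)"
    using krawtchouk_Suc_same_column[of r "nat (int M - j)" "nat j" n] j that
    by (simp add: defs nat_add_distrib[symmetric])
  \<comment> \<open>In column \<open>j = Suc M\<close> the values \<open>A\<close> and
    \<open>A'\<close> are the default 0 while \<open>F\<close> need not vanish; the factor
    \<open>x = 0\<close> rescues the identity.\<close>
  then have xF: "x * F = x * (A + A')"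
    by (cases "j = int (Suc M)") (simp_all add: x_def)
  have BG: "F = B - r * B'" "G = B + B'" if "j \<noteq> 0"
    using krawtchouk_Suc_next_column[of r "nat (int (Suc M) - j)" "nat (j - 1)" n]
      krawtchouk_Suc_same_column[of r "nat (int (Suc M) - j)" "nat (j - 1)" n] j that
    by (simp_all add: defs nat_add_distrib[symmetric])
  have yF: "y * F = y * (B - r * B')"
    using BG by (cases "j = 0") (simp_all add: y_def)
  \<comment> \<open>The cross terms in \<open>B * B'\<close> cancel, leaving the factor
    \<open>1 + r\<close> that clears the denominator.\<close>
  have "y * (r * G\<^sup>2 + F\<^sup>2) = y * ((1 + r) * (B\<^sup>2 + r * B'\<^sup>2))"
  proof (cases "j = 0")
    case False
    show ?thesis
      unfolding BG[OF False] by algebra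
  qed (simp add: y_def)
  then have corr: "(1 - r) / (1 + r) * y * (r * G\<^sup>2 + F\<^sup>2) = (1 - r) * y * (B\<^sup>2 + r * B'\<^sup>2)"
    using assms(1) by (auto simp: mult.assoc)
  have "(x + y - 2 * real_of_int n) * F\<^sup>2 = x * (A\<^sup>2 - A'\<^sup>2) + y * (B\<^sup>2 - r\<^sup>2 * B'\<^sup>2)"
  proof -
    have "(x + y - 2 * real_of_int n) * F = x * (A - A') + y * (B + r * B')"
      using deriv xF yF by (simp add: algebra_simps)
    \<comment> \<open>The second \<open>F\<close> is grouped with \<open>x\<close> and
      \<open>y\<close>, since \<open>xF\<close> and \<open>yF\<close> also hold in the boundary
      columns.\<close>
    then have "(x + y - 2 * real_of_int n) * F * F = (x * F) * (A - A') + (y * F) * (B + r * B')"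
      by (simp only:) (simp add: algebra_simps)
    then show ?thesis
      unfolding xF yF by (simp add: power2_eq_square algebra_simps)
  qed
  also have "\<dots> = x * (A\<^sup>2 - A'\<^sup>2) + r * y * (B\<^sup>2 - B'\<^sup>2) + (1 - r) * y * (B\<^sup>2 + r * B'\<^sup>2)"
    by algebra
  finally show ?thesis
    unfolding corr[symmetric] by (simp add: defs x_def y_def)
qed

theorem theorem3p1:
  fixes p r :: real and N :: nat and j m :: int
  assumes "p \<noteq> 0"
    and "r = (1 - p) / p"
    and "N \<ge> 1"
    and "0 \<le> j" and "j \<le> int N"
    and "0 \<le> m" and "m \<le> int N"
  shows "(\<Sum>n = 0..m. (real N - 2 * real_of_int n) * (krawtchouk r N n j)\<^sup>2) =
      (real N - real_of_int j) * (krawtchouk r (N - 1) m j)\<^sup>2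
      + r * real_of_int j * (krawtchouk r (N - 1) m (j - 1))\<^sup>2
      + (1 - r) / (1 + r) * real_of_int j *
          (\<Sum>n = 0..m. r * (krawtchouk r N n (j - 1))\<^sup>2 + (krawtchouk r N n j)\<^sup>2)"
proof -
  obtain M where N: "N = Suc M"
    using assms(3) by (cases N) auto
  have "1 + r = 1 / p"
    using assms(1,2) by (simp add: diff_divide_distrib)
  then have r: "1 + r \<noteq> 0"
    using assms(1) by simp
  \<comment> \<open>Starting the induction at -1 makes the base case an empty sum against zero
    values; the term \<open>n = 0\<close> becomes an ordinary step.\<close>
  have "- 1 \<le> m"
    using assms(6) by simp
  then show ?thesis
  proof (induction m rule: int_ge_induct)
    case base
    show ?case
      by (simp add: krawtchouk_def)
  next
    case (step i)
    have "{0..i + 1} = insert (i + 1) {0..i}"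
      using step.hyps by auto
    moreover note step.IH
    moreover have "(real N - 2 * real_of_int (i + 1)) * (krawtchouk r N (i + 1) j)\<^sup>2 =
      (real N - j) * ((krawtchouk r (N - 1) (i + 1) j)\<^sup>2 - (krawtchouk r (N - 1) i j)\<^sup>2)
      + r * j * ((krawtchouk r (N - 1) (i + 1) (j - 1))\<^sup>2 - (krawtchouk r (N - 1) i (j - 1))\<^sup>2)
      + (1 - r) / (1 + r) * j *
          (r * (krawtchouk r N (i + 1) (j - 1))\<^sup>2 + (krawtchouk r N (i + 1) j)\<^sup>2)"
      using krawtchouk_square_step[OF r, of j M "i + 1"] assms(4,5) by (simp add: N)
    ultimately show ?case
      by (simp add: distrib_left right_diff_distrib)
  qed
qed

end
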